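(* Let $\mathfrak{so}(3,\mathbb{C})$ be the complex Lie algebra on $\mathbb{C}^3$ with canonical basis $\{e_1,e_2,e_3\}$ and bracket $[e_1,e_2]=e_3$, $[e_2,e_3]=e_1$, $[e_3,e_1]=e_2$. Any hom-Lie algebra $(\mathfrak{so}(3,\mathbb{C}),A)$ with $A$ a nilpotent operator is isomorphic to some hom-Lie algebra $\mathfrak{L}_7^i:=(\mathfrak{so}(3,\mathbb{C}),A_i)$, $i\in\{0,1,2\}$, where $A_0$ is the zero map and the matrices of $A_1,A_2$ with respect to the ordered basis $\{e_1,e_2,e_3\}$ are $$A_1=\begin{pmatrix}0&0&0\\0&1&\sqrt{-1}\\0&\sqrt{-1}&-1\end{pmatrix},\qquad A_2=\begin{pmatrix}0&1&\sqrt{-1}\\1&0&0\\\sqrt{-1}&0&0\end{pmatrix}.$$ Moreover, two hom-Lie algebras $(\mathfrak{so}(3,\mathbb{C}),A_i)$ and $(\mathfrak{so}(3,\mathbb{C}),A_j)$ are isomorphic if and only if $A_i=A_j$.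
   Context: A complex hom-Lie algebra is a triple $(V,\cdot,A)$, where $V$ is a complex vector space, $\cdot$ is a skew-symmetric bilinear product on $V$, and $A:V\to V$ is a linear map (the twisting map) satisfying the hom-Jacobi identity $$\sum_{\sigma\in S_3}\operatorname{sign}(\sigma)\,Ax_{\sigma(1)}\cdot(x_{\sigma(2)}\cdot x_{\sigma(3)})=0\quad\text{for all }x_1,x_2,x_3\in V.$$ For a Lie algebra $\mathfrak{g}$, a hom-Lie algebra $(\mathfrak{g},A)$ is one whose product is the Lie bracket of $\mathfrak{g}$. An isomorphism of hom-Lie algebras $(V,\cdot,A)\to(U,\ast,B)$ is an invertible linear map $g:V\to U$ with $g(x\cdot y)=(gx)\ast(gy)$ for all $x,y\in V$ and $g\circ A=B\circ g$. In the matrix of a linear map, the $j$-th column is the coordinate vector of the image of $e_j$. *)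

theory Defs
  imports "HOL-Analysis.Analysis"
begin

text \<open>The carrier of a complex vector space is a whole type; the scalar multiplication is an
  explicit parameter. For \<^typ>\<open>complex^'n\<close> it is \<^term>\<open>(*s)\<close>, as \<^term>\<open>(*\<^sub>R)\<close> would only give
  real linearity.\<close>

locale hom_lie_algebra = vector_space scale
  for scale :: "complex \<Rightarrow> 'v::ab_group_add \<Rightarrow> 'v" +
  fixes mult :: "'v \<Rightarrow> 'v \<Rightarrow> 'v"
    and twist :: "'v \<Rightarrow> 'v"
  assumes linear_mult_left: "\<And>y. Vector_Spaces.linear scale scale (\<lambda>x. mult x y)"
    and linear_mult_right: "\<And>x. Vector_Spaces.linear scale scale (\<lambda>y. mult x y)"
    and skew: "\<And>x y. mult x y = - mult y x"
    and linear_twist: "Vector_Spaces.linear scale scale twist"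
    and hom_jacobi: "\<And>x :: nat \<Rightarrow> 'v.
      (\<Sum>\<sigma> | \<sigma> permutes {1, 2, 3}.
         scale (of_int (sign \<sigma>)) (mult (twist (x (\<sigma> 1))) (mult (x (\<sigma> 2)) (x (\<sigma> 3))))) = 0"

locale hom_lie_isomorphism =
  V: hom_lie_algebra scaleV multV twistV + U: hom_lie_algebra scaleU multU twistU
  for scaleV :: "complex \<Rightarrow> 'v::ab_group_add \<Rightarrow> 'v" and multV twistV
    and scaleU :: "complex \<Rightarrow> 'u::ab_group_add \<Rightarrow> 'u" and multU twistU +
  fixes g :: "'v \<Rightarrow> 'u"
  assumes linear_iso: "Vector_Spaces.linear scaleV scaleU g"
    and bij_iso: "bij g"
    and iso_mult: "\<And>x y. g (multV x y) = multU (g x) (g y)"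
    and iso_twist: "g \<circ> twistV = twistU \<circ> g"

definition nilpotent_map :: "('v::zero \<Rightarrow> 'v) \<Rightarrow> bool" where
  "nilpotent_map A \<longleftrightarrow> (\<exists>n. \<forall>x. (A ^^ n) x = 0)"

definition so3_bracket :: "complex^3 \<Rightarrow> complex^3 \<Rightarrow> complex^3" where
  "so3_bracket x y =
     vector [x$2 * y$3 - x$3 * y$2, x$3 * y$1 - x$1 * y$3, x$1 * y$2 - x$2 * y$1]"

text \<open>The coordinate formula is the skew-symmetric bilinear extension of the relations
  \<open>[e1, e2] = e3\<close>, \<open>[e2, e3] = e1\<close>, \<open>[e3, e1] = e2\<close>.\<close>

lemma so3_bracket_basis:
  "so3_bracket (axis 1 1) (axis 2 1) = axis 3 1"
  "so3_bracket (axis 2 1) (axis 3 1) = axis 1 1"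
  "so3_bracket (axis 3 1) (axis 1 1) = axis 2 1"
  by (simp_all add: so3_bracket_def vec_eq_iff forall_3 axis_def)

lemma so3_bracket_skew: "so3_bracket x y = - so3_bracket y x"
  by (simp add: so3_bracket_def vec_eq_iff forall_3)

lemma so3_bracket_linear:
  "Vector_Spaces.linear (*s) (*s) (\<lambda>x. so3_bracket x y)"
  "Vector_Spaces.linear (*s) (*s) (\<lambda>y. so3_bracket x y)"
  by (unfold_locales; simp add: so3_bracket_def vec_eq_iff forall_3 algebra_simps)+

abbreviation so3_hom_lie :: "(complex^3 \<Rightarrow> complex^3) \<Rightarrow> bool" where
  "so3_hom_lie A \<equiv> hom_lie_algebra (*s) so3_bracket A"

definition so3_isomorphic ::
  "(complex^3 \<Rightarrow> complex^3) \<Rightarrow> (complex^3 \<Rightarrow> complex^3) \<Rightarrow> bool" where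
  "so3_isomorphic A B \<longleftrightarrow> (\<exists>g. hom_lie_isomorphism (*s) so3_bracket A (*s) so3_bracket B g)"

text \<open>Only the indices 0, 1, 2 are meaningful. The inner vectors are the rows.\<close>

definition L7_matrix :: "nat \<Rightarrow> complex^3^3" where
  "L7_matrix i =
    (if i = 0 then 0
     else if i = 1 then
       vector [vector [0, 0, 0],
               vector [0, 1, \<i>],
               vector [0, \<i>, -1]]
     else
       vector [vector [0, 1, \<i>],
               vector [1, 0, 0],
               vector [\<i>, 0, 0]])"

definition L7_twist :: "nat \<Rightarrow> complex^3 \<Rightarrow> complex^3" where
  "L7_twist i = (\<lambda>x. L7_matrix i *v x)"

end

theory Submission
  imports Defs
begin

text \<open>Everything is expressed through the complex bilinear dot product on \<open>\<complex>\<^sup>3\<close>, for which the bracket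
  is the cross product. On basis vectors the hom-Jacobi identity says
  \<open>\<Sum>\<^sub>i [A e\<^sub>i, e\<^sub>i] = 0\<close>, and the coordinates of this vector are the differences of opposite
  off-diagonal entries of \<open>A\<close>. So the hom-Lie structures on \<open>so(3)\<close> are exactly the self-adjoint
  \<open>A\<close> (\<open>so3_hom_lie_iff\<close>). If \<open>f\<^sub>1, f\<^sub>2\<close> are orthonormal and \<open>f\<^sub>3 = [f\<^sub>1, f\<^sub>2]\<close>, then taking
  coordinates in this frame is an automorphism of the Lie algebra, so classifying hom-Lie
  structures amounts to finding a frame in which \<open>A\<close> has a prescribed matrix
  (\<open>so3_frame_isomorphic\<close>).

  The main geometric fact is that totally isotropic subspaces of \<open>\<complex>\<^sup>3\<close> are at most
  one-dimensional (\<open>totally_isotropic_parallel\<close>). It is used twice. If \<open>A\<close> were nilpotent of index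
  \<open>N \<ge> 4\<close>, the images of a vector under \<open>A\<^bsup>N-2\<^esup>\<close> and \<open>A\<^bsup>N-1\<^esup>\<close> would span a totally isotropic
  subspace, hence be parallel; but if the second image is nonzero, they are not, because \<open>A\<close> kills
  it and not the first one. So \<open>A\<^sup>3 = 0\<close>
  (\<open>nilpotent_cube_zero\<close>). If \<open>A\<^sup>2 = 0 \<noteq> A\<close>, the image of \<open>A\<close> is totally isotropic, so
  \<open>A = v v\<^sup>T\<close> for an isotropic \<open>v\<close>; in a frame with \<open>v = f\<^sub>2 + \<i> f\<^sub>3\<close> this is \<open>A\<^sub>1\<close>
  (\<open>square_zero_isomorphic\<close>). If \<open>A\<^sup>2 \<noteq> 0 = A\<^sup>3\<close>, a suitable chain \<open>y, f = A y, v = A f\<close>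
  gives a frame containing \<open>f\<close> in which \<open>A\<close> is \<open>A\<^sub>2\<close> (\<open>cube_zero_isomorphic\<close>).

  The three normal forms are told apart by the least power that vanishes, which an isomorphism
  preserves (\<open>so3_isomorphic_funpow_zero_iff\<close>).\<close>

section \<open>The bilinear dot product and the bracket\<close>

text \<open>Bilinear rather than Hermitian: nonzero vectors can be isotropic (orthogonal to themselves), and
  every nonisotropic vector can be rescaled to have square 1.\<close>
definition cdot :: "complex^3 \<Rightarrow> complex^3 \<Rightarrow> complex" where
  "cdot x y = x$1 * y$1 + x$2 * y$2 + x$3 * y$3"

definition self_adjoint :: "(complex^3 \<Rightarrow> complex^3) \<Rightarrow> bool" where
  "self_adjoint A \<longleftrightarrow> (\<forall>x y. cdot (A x) y = cdot x (A y))"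

lemma self_adjointD: "self_adjoint A \<Longrightarrow> cdot (A x) y = cdot x (A y)"
  by (simp add: self_adjoint_def)

lemma cdot_commute: "cdot x y = cdot y x"
  by (simp add: cdot_def algebra_simps)

lemma cdot_bilinear:
  "cdot (x + y) z = cdot x z + cdot y z" "cdot z (x + y) = cdot z x + cdot z y"
  "cdot (x - y) z = cdot x z - cdot y z" "cdot z (x - y) = cdot z x - cdot z y"
  "cdot (- x) z = - cdot x z" "cdot z (- x) = - cdot z x"
  "cdot (c *s x) z = c * cdot x z" "cdot z (c *s x) = c * cdot z x"
  "cdot 0 z = 0" "cdot z 0 = 0"
  by (simp_all add: cdot_def algebra_simps)

lemma cdot_nondegenerate: "(\<And>y. cdot x y = 0) \<Longrightarrow> x = 0"
proof -
  assume "\<And>y. cdot x y = 0"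
  from this[of "axis 1 1"] this[of "axis 2 1"] this[of "axis 3 1"]
  show "x = 0" by (simp add: cdot_def axis_def vec_eq_iff forall_3)
qed

text \<open>Polarization; it supplies a vector with \<open>A u \<cdot> u \<noteq> 0\<close> whenever a self-adjoint \<open>A\<close> is
  nonzero.\<close>
lemma self_adjoint_polarization:
  assumes "Vector_Spaces.linear (*s) (*s) A" "self_adjoint A" "\<And>u. cdot (A u) u = 0"
  shows "A x = 0"
proof (rule cdot_nondegenerate)
  fix y
  have "A (x + y) = A x + A y"
    using assms(1) by (simp add: Vector_Spaces.linear_iff)
  then have "2 * cdot (A x) y = 0"
    using assms(3)[of "x + y"] assms(3)[of x] assms(3)[of y] self_adjointD[OF assms(2), of y x]
    by (simp add: cdot_bilinear cdot_commute)
  then show "cdot (A x) y = 0" by simp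
qed

lemma bracket_cdot:
  "cdot (so3_bracket x y) (so3_bracket z w) = cdot x z * cdot y w - cdot x w * cdot y z"
  by (simp add: cdot_def so3_bracket_def algebra_simps)

lemma bracket_bracket:
  "so3_bracket x (so3_bracket y z) = cdot x z *s y - cdot x y *s z"
  by (simp add: cdot_def so3_bracket_def vec_eq_iff forall_3 algebra_simps)

lemma cdot_bracket_left: "cdot x (so3_bracket x y) = 0" "cdot y (so3_bracket x y) = 0"
  by (simp_all add: cdot_def so3_bracket_def algebra_simps)

text \<open>Expansion of \<open>w\<close> in the basis dual to \<open>x, y, z\<close>, multiplied by their determinant so that it holds
  for dependent vectors too.\<close>
lemma cramer_expansion:
  "cdot x (so3_bracket y z) *s w
     = cdot w x *s so3_bracket y z + cdot w y *s so3_bracket z x + cdot w z *s so3_bracket x y"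
  by (simp add: cdot_def so3_bracket_def vec_eq_iff forall_3 algebra_simps)

lemma gram_determinant:
  "(cdot c (so3_bracket a b))\<^sup>2 =
     cdot a a * (cdot b b * cdot c c - cdot b c * cdot b c)
     - cdot a b * (cdot a b * cdot c c - cdot b c * cdot a c)
     + cdot a c * (cdot a b * cdot b c - cdot b b * cdot a c)"
  unfolding cdot_def so3_bracket_def power2_eq_square by (simp add: algebra_simps)

text \<open>Under these hypotheses the Gram determinant of \<open>a, b, c\<close> vanishes for every \<open>c\<close>. It is the square
  of \<open>c \<cdot> [a, b]\<close>, so \<open>[a, b] = 0\<close>, and the conclusion is the expansion of \<open>[c, [a, b]]\<close>. The
  vector \<open>c\<close> is what later turns parallelism into an explicit scalar.\<close>
lemma totally_isotropic_parallel:
  assumes "cdot a a = 0" "cdot a b = 0" "cdot b b = 0"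
  shows "cdot b c *s a = cdot a c *s b"
proof -
  have "so3_bracket a b = 0"
  proof (rule cdot_nondegenerate)
    fix y show "cdot (so3_bracket a b) y = 0"
      using gram_determinant[of y a b] assms by (simp add: cdot_commute)
  qed
  then have "so3_bracket c (so3_bracket a b) = 0"
    by (simp add: so3_bracket_def vec_eq_iff forall_3)
  then show ?thesis
    by (simp add: bracket_bracket cdot_commute)
qed

section \<open>The hom-Jacobi identity as self-adjointness\<close>

lemma sum_permutations_3:
  fixes F :: "nat \<Rightarrow> nat \<Rightarrow> nat \<Rightarrow> 'v :: ab_group_add" and scale :: "complex \<Rightarrow> 'v \<Rightarrow> 'v"
  assumes "\<And>v. scale 1 v = v" "\<And>v. scale (- 1) v = - v"
  shows "(\<Sum>\<sigma> | \<sigma> permutes {1, 2, 3}. scale (of_int (sign \<sigma>)) (F (\<sigma> 1) (\<sigma> 2) (\<sigma> 3)))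
    = F 1 2 3 + F 2 3 1 + F 3 1 2 - F 1 3 2 - F 2 1 3 - F 3 2 1"
proof -
  have f12: "finite {2, 3::nat}" "1 \<notin> {2, 3::nat}" by auto
  have f23: "finite {3::nat}" "2 \<notin> {3::nat}" by auto
  show ?thesis
    unfolding sum_over_permutations_insert[OF f12] sum_over_permutations_insert[OF f23]
      permutes_sing
    by (simp add: sign_swap_id permutation_swap_id sign_compose swap_id_eq assms)
qed

text \<open>The hom-Jacobi sum is alternating and trilinear in its three arguments, so it is determined by its
  value at the canonical basis. That value is \<open>2 \<Sum>\<^sub>i [A e\<^sub>i, e\<^sub>i]\<close>, whose coordinates
  are, up to sign, twice the differences \<open>M\<^sub>i\<^sub>j - M\<^sub>j\<^sub>i\<close> of matrix entries.\<close>
lemma hom_jacobi_iff_self_adjoint: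
  assumes lin: "Vector_Spaces.linear (*s) (*s) A"
  shows "(\<forall>x :: nat \<Rightarrow> complex^3. (\<Sum>\<sigma> | \<sigma> permutes {1, 2, 3}.
           of_int (sign \<sigma>) *s so3_bracket (A (x (\<sigma> 1))) (so3_bracket (x (\<sigma> 2)) (x (\<sigma> 3)))) = 0)
         \<longleftrightarrow> self_adjoint A" (is "?J \<longleftrightarrow> _")
proof -
  define M where "M = matrix A"
  have A: "A = (\<lambda>x. M *v x)"
    unfolding M_def using matrix_works[OF lin] by auto
  note entries = matrix_vector_mult_def sum_3 so3_bracket_def cdot_def axis_def vec_eq_iff forall_3
  have J: "?J \<longleftrightarrow> (\<forall>x :: nat \<Rightarrow> complex^3.
       so3_bracket (A (x 1)) (so3_bracket (x 2) (x 3))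
     + so3_bracket (A (x 2)) (so3_bracket (x 3) (x 1))
     + so3_bracket (A (x 3)) (so3_bracket (x 1) (x 2))
     - so3_bracket (A (x 1)) (so3_bracket (x 3) (x 2))
     - so3_bracket (A (x 2)) (so3_bracket (x 1) (x 3))
     - so3_bracket (A (x 3)) (so3_bracket (x 2) (x 1)) = 0)" (is "_ \<longleftrightarrow> (\<forall>x. ?S x)")
    by (subst sum_permutations_3[where F = "\<lambda>i j k. so3_bracket (A (_ i)) (so3_bracket (_ j) (_ k))"]) auto
  have sym: "self_adjoint A \<longleftrightarrow> M$1$2 = M$2$1 \<and> M$1$3 = M$3$1 \<and> M$2$3 = M$3$2"
  proof
    assume sa: "self_adjoint A"
    show "M$1$2 = M$2$1 \<and> M$1$3 = M$3$1 \<and> M$2$3 = M$3$2"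
      using self_adjointD[OF sa, of "axis 1 1" "axis 2 1"]
        self_adjointD[OF sa, of "axis 1 1" "axis 3 1"]
        self_adjointD[OF sa, of "axis 2 1" "axis 3 1"]
      by (simp add: A entries)
  next
    assume "M$1$2 = M$2$1 \<and> M$1$3 = M$3$1 \<and> M$2$3 = M$3$2"
    then show "self_adjoint A"
      by (simp add: self_adjoint_def A entries algebra_simps)
  qed
  show ?thesis
    unfolding J
  proof
    assume S: "\<forall>x. ?S x"
    show "self_adjoint A"
      unfolding sym
      using S[rule_format, of "\<lambda>i. if i = 1 then axis 1 1 else if i = 2 then axis 2 1 else axis 3 1"]
      by (simp add: A entries)
  next
    assume "self_adjoint A"
    then show "\<forall>x. ?S x"
      unfolding sym by (simp add: A entries algebra_simps)
  qed
qed

lemma so3_hom_lie_iff: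
  "so3_hom_lie A \<longleftrightarrow> Vector_Spaces.linear (*s) (*s) A \<and> self_adjoint A"
proof
  assume "so3_hom_lie A"
  then interpret hom_lie_algebra "(*s)" so3_bracket A .
  show "Vector_Spaces.linear (*s) (*s) A \<and> self_adjoint A"
    using linear_twist hom_jacobi hom_jacobi_iff_self_adjoint[OF linear_twist] by simp
next
  assume *: "Vector_Spaces.linear (*s) (*s) A \<and> self_adjoint A"
  show "so3_hom_lie A"
  proof (intro hom_lie_algebra.intro hom_lie_algebra_axioms.intro)
    show "vector_space ((*s) :: complex \<Rightarrow> complex^3 \<Rightarrow> complex^3)"
      by (rule vec.vector_space_axioms)
    show "so3_bracket x y = - so3_bracket y x" for x y
      by (rule so3_bracket_skew)
    show "(\<Sum>\<sigma> | \<sigma> permutes {1, 2, 3}. of_int (sign \<sigma>) *s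
        so3_bracket (A (x (\<sigma> 1))) (so3_bracket (x (\<sigma> 2)) (x (\<sigma> 3)))) = 0" for x :: "nat \<Rightarrow> complex^3"
      using * hom_jacobi_iff_self_adjoint[of A] by blast
  qed (use * in \<open>simp_all add: so3_bracket_linear\<close>)
qed

section \<open>Frames and automorphisms\<close>

text \<open>Exactly the images of the canonical basis under automorphisms of the Lie algebra. The third vector is
  kept as an argument to let the cyclic symmetry show.\<close>
definition so3_frame :: "complex^3 \<Rightarrow> complex^3 \<Rightarrow> complex^3 \<Rightarrow> bool" where
  "so3_frame f1 f2 f3 \<longleftrightarrow>
     cdot f1 f1 = 1 \<and> cdot f2 f2 = 1 \<and> cdot f1 f2 = 0 \<and> f3 = so3_bracket f1 f2"

lemma so3_frame_brackets:
  assumes "so3_frame f1 f2 f3"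
  shows "so3_bracket f1 f2 = f3" "so3_bracket f2 f3 = f1" "so3_bracket f3 f1 = f2"
  using assms so3_bracket_skew[of f3 f1]
  by (simp_all add: so3_frame_def bracket_bracket cdot_commute)

lemma so3_frame_orthonormal:
  assumes "so3_frame f1 f2 f3"
  shows "cdot f1 f1 = 1" "cdot f2 f2 = 1" "cdot f3 f3 = 1"
    "cdot f1 f2 = 0" "cdot f1 f3 = 0" "cdot f2 f3 = 0"
    "cdot f2 f1 = 0" "cdot f3 f1 = 0" "cdot f3 f2 = 0"
  using assms bracket_cdot[of f1 f2 f1 f2]
  by (simp_all add: so3_frame_def cdot_bracket_left cdot_commute)

lemma so3_frame_expansion:
  assumes "so3_frame f1 f2 f3"
  shows "x = cdot f1 x *s f1 + cdot f2 x *s f2 + cdot f3 x *s f3"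
  using cramer_expansion[of f1 f2 f3 x] so3_frame_brackets[OF assms] so3_frame_orthonormal[OF assms]
  by (simp add: cdot_commute)

text \<open>Coordinates with respect to a frame preserve the bracket because
  \<open>f\<^sub>1 \<cdot> [x, y] = [f\<^sub>2, f\<^sub>3] \<cdot> [x, y]\<close> expands by the Binet-Cauchy identity, and cyclically. It
  remains to compare coordinates of \<open>A x\<close> with those of \<open>x\<close>, which self-adjointness reduces to
  the values of \<open>A\<close> on the frame.\<close>
lemma so3_frame_isomorphic:
  fixes f1 f2 f3 :: "complex^3"
  defines "g \<equiv> \<lambda>x. vector [cdot f1 x, cdot f2 x, cdot f3 x] :: complex^3"
  assumes frame: "so3_frame f1 f2 f3"
    and A: "so3_hom_lie A" and B: "so3_hom_lie B"
    and intertwines: "\<And>x. g (A x) = B (g x)"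
  shows "so3_isomorphic A B"
proof -
  interpret A: hom_lie_algebra "(*s)" so3_bracket A by fact
  interpret B: hom_lie_algebra "(*s)" so3_bracket B by fact
  have "hom_lie_isomorphism (*s) so3_bracket A (*s) so3_bracket B g"
  proof unfold_locales
    show "g (x + y) = g x + g y" "g (c *s x) = c *s g x" for x y c
      by (simp_all add: g_def vec_eq_iff forall_3 cdot_bilinear)
    show "bij g"
    proof (rule o_bij)
      define h where "h z = z$1 *s f1 + z$2 *s f2 + z$3 *s f3" for z :: "complex^3"
      show "h \<circ> g = id"
        using so3_frame_expansion[OF frame] by (auto simp: h_def g_def)
      show "g \<circ> h = id"
        by (auto simp: h_def g_def vec_eq_iff forall_3 cdot_bilinear so3_frame_orthonormal[OF frame])
    qed
    show "g (so3_bracket x y) = so3_bracket (g x) (g y)" for x y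
    proof -
      note f = so3_frame_brackets[OF frame]
      have "cdot f1 (so3_bracket x y) = cdot f2 x * cdot f3 y - cdot f2 y * cdot f3 x"
        "cdot f2 (so3_bracket x y) = cdot f3 x * cdot f1 y - cdot f3 y * cdot f1 x"
        "cdot f3 (so3_bracket x y) = cdot f1 x * cdot f2 y - cdot f1 y * cdot f2 x"
        using bracket_cdot[of f2 f3 x y] bracket_cdot[of f3 f1 x y] bracket_cdot[of f1 f2 x y]
        by (simp_all add: f)
      then show ?thesis
        by (simp add: g_def so3_bracket_def[of "vector _"] vec_eq_iff forall_3 algebra_simps)
    qed
    show "g \<circ> A = B \<circ> g"
      using intertwines by auto
  qed
  then show ?thesis
    by (auto simp: so3_isomorphic_def)
qed

section \<open>The normal forms are pairwise non-isomorphic\<close>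

lemma L7_twist_simps:
  "L7_twist 0 x = 0"
  "L7_twist 1 x = vector [0, x$2 + \<i> * x$3, \<i> * x$2 - x$3]"
  "L7_twist 2 x = vector [x$2 + \<i> * x$3, x$1, \<i> * x$1]"
  by (simp_all add: L7_twist_def L7_matrix_def matrix_vector_mult_def sum_3 vec_eq_iff forall_3)

lemma so3_hom_lie_L7:
  assumes "i \<in> {0, 1, 2}"
  shows "so3_hom_lie (L7_twist i)"
  unfolding so3_hom_lie_iff
proof
  show "Vector_Spaces.linear (*s) (*s) (L7_twist i)"
    unfolding L7_twist_def by (rule matrix_vector_mul_linear_gen)
  have "cdot (L7_twist 0 x) y = cdot x (L7_twist 0 y)"
    "cdot (L7_twist 1 x) y = cdot x (L7_twist 1 y)"
    "cdot (L7_twist 2 x) y = cdot x (L7_twist 2 y)" for x y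
    unfolding L7_twist_simps cdot_def by (simp_all add: algebra_simps)
  then show "self_adjoint (L7_twist i)"
    using assms unfolding self_adjoint_def by blast
qed

lemma L7_twist_1_square: "L7_twist 1 (L7_twist 1 x) = 0"
  by (simp add: L7_twist_simps vec_eq_iff forall_3 algebra_simps del: One_nat_def)

lemma L7_twist_nonzero:
  "L7_twist 1 (axis 2 1) \<noteq> 0"
  "L7_twist 2 (L7_twist 2 (axis 2 1)) \<noteq> 0"
  by (simp_all add: L7_twist_simps vec_eq_iff forall_3 axis_def del: One_nat_def)

lemma so3_isomorphic_refl:
  assumes "so3_hom_lie A"
  shows "so3_isomorphic A A"
proof (rule so3_frame_isomorphic[of "axis 1 1" "axis 2 1" "axis 3 1"])
  show "so3_frame (axis 1 1) (axis 2 1) (axis 3 1)"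
    unfolding so3_frame_def so3_bracket_basis by (simp add: cdot_def axis_def)
  have "vector [cdot (axis 1 1) x, cdot (axis 2 1) x, cdot (axis 3 1) x] = x" for x
    by (simp add: cdot_def axis_def vec_eq_iff forall_3)
  then show "vector [cdot (axis 1 1) (A x), cdot (axis 2 1) (A x), cdot (axis 3 1) (A x)] =
         A (vector [cdot (axis 1 1) x, cdot (axis 2 1) x, cdot (axis 3 1) x])" for x
    by simp
qed fact+

lemma so3_isomorphic_funpow_zero_iff:
  assumes "so3_isomorphic A B"
  shows "(\<forall>x. (A ^^ n) x = 0) \<longleftrightarrow> (\<forall>x. (B ^^ n) x = 0)"
proof -
  obtain g where "hom_lie_isomorphism (*s) so3_bracket A (*s) so3_bracket B g"
    using assms by (auto simp: so3_isomorphic_def)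
  then interpret hom_lie_isomorphism "(*s)" so3_bracket A "(*s)" so3_bracket B g .
  interpret g: Vector_Spaces.linear "(*s)" "(*s)" g by (rule linear_iso)
  have g: "g (A x) = B (g x)" for x
    using iso_twist by (metis comp_apply)
  have pow: "g ((A ^^ n) x) = (B ^^ n) (g x)" for x
    by (induction n) (simp_all add: g)
  have "(A ^^ n) x = 0 \<longleftrightarrow> (B ^^ n) (g x) = 0" for x
    using pow[of x] g.zero bij_is_inj[OF bij_iso] by (metis injD)
  then show ?thesis
    using bij_is_surj[OF bij_iso] by (metis surj_def)
qed

lemma L7_twist_nonisomorphic:
  assumes "i \<in> {0, 1, 2}" "j \<in> {0, 1, 2}" "so3_isomorphic (L7_twist i) (L7_twist j)"
  shows "i = j"
proof -
  note inv = so3_isomorphic_funpow_zero_iff[OF assms(3)]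
  have one: "(\<forall>x. (L7_twist k ^^ 1) x = 0) \<longleftrightarrow> k = 0"
   and two: "(\<forall>x. (L7_twist k ^^ 2) x = 0) \<longleftrightarrow> k \<noteq> 2" if "k \<in> {0, 1, 2}" for k
  proof -
    have pow: "(L7_twist k ^^ 1) x = L7_twist k x"
      "(L7_twist k ^^ 2) x = L7_twist k (L7_twist k x)" for x
      by (simp_all add: numeral_2_eq_2)
    have "L7_twist 2 (axis 2 1) \<noteq> 0"
      using L7_twist_nonzero(2) by (auto simp: L7_twist_simps vec_eq_iff forall_3)
    then show "(\<forall>x. (L7_twist k ^^ 1) x = 0) \<longleftrightarrow> k = 0"
      unfolding pow using that L7_twist_nonzero(1) L7_twist_simps(1) by blast
    show "(\<forall>x. (L7_twist k ^^ 2) x = 0) \<longleftrightarrow> k \<noteq> 2"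
      unfolding pow using that L7_twist_nonzero(2) L7_twist_1_square L7_twist_simps(1)
      by (metis insertE singletonD zero_neq_numeral one_eq_numeral_iff num.distinct(1))
  qed
  have "i = 0 \<longleftrightarrow> j = 0" "i = 2 \<longleftrightarrow> j = 2"
    using inv[of 1] inv[of 2] one[OF assms(1)] one[OF assms(2)] two[OF assms(1)] two[OF assms(2)]
    by blast+
  then show ?thesis
    using assms(1,2) by blast
qed

section \<open>Normal forms of nilpotent self-adjoint maps\<close>

text \<open>Adding a multiple of the isotropic vector \<open>v\<close> to \<open>y\<close> changes \<open>y \<cdot> y\<close> linearly, so \<open>y\<close> can be
  normalized to a unit vector \<open>f\<^sub>2\<close>, still with \<open>f\<^sub>2 \<cdot> v = 1\<close>. Then \<open>v = f\<^sub>2 + k f\<^sub>3\<close>, and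
  \<open>v \<cdot> v = 0\<close> forces \<open>k\<^sup>2 = -1\<close>. Both signs of \<open>k\<close> occur: they correspond to the two orientations of
  \<open>f\<close> relative to \<open>v\<close>. The explicit \<open>f\<^sub>2\<close> is exported since \<open>A f\<^sub>2\<close> is computed from it when
  \<open>A v = 0\<close>.\<close>
lemma isotropic_adapted_frame:
  assumes "cdot f f = 1" "cdot f v = 0" "cdot v v = 0" "cdot y v = 1" "cdot f y = 0"
  obtains f2 f3 k where "so3_frame f f2 f3" "v = f2 + k *s f3" "k = \<i> \<or> k = - \<i>"
    "f2 = y + ((1 - cdot y y) / 2) *s v"
proof -
  define f2 where "f2 = y + ((1 - cdot y y) / 2) *s v"
  define f3 where "f3 = so3_bracket f f2"
  define k where "k = cdot f3 v"
  have "cdot v y = 1" using assms(4) by (simp add: cdot_commute)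
  then have "cdot f2 f2 = 1" "cdot f f2 = 0" "cdot f2 v = 1"
    using assms by (simp_all add: f2_def cdot_bilinear field_simps)
  then have frame: "so3_frame f f2 f3"
    using assms by (simp add: so3_frame_def f3_def)
  have v: "v = f2 + k *s f3"
    using so3_frame_expansion[OF frame, of v] \<open>cdot f v = 0\<close> \<open>cdot f2 v = 1\<close> by (simp add: k_def)
  have "cdot (f2 + k *s f3) (f2 + k *s f3) = 1 + k\<^sup>2"
    by (simp add: cdot_bilinear so3_frame_orthonormal[OF frame] power2_eq_square)
  then have "1 + k\<^sup>2 = 0"
    using assms(3) unfolding v[symmetric] by simp
  then have "k\<^sup>2 = \<i>\<^sup>2"
    by (simp add: eq_neg_iff_add_eq_0 add.commute)
  then have "k = \<i> \<or> k = - \<i>"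
    by (simp only: power2_eq_iff)
  with frame v show ?thesis using that f2_def by blast
qed

text \<open>Since \<open>A x \<cdot> A z = x \<cdot> A (A z) = 0\<close>, the image of \<open>A\<close> is totally isotropic, hence a line
  spanned by some \<open>v\<close>; with the right scaling of \<open>v\<close>, self-adjointness gives \<open>A x = (v \<cdot> x) v\<close>. The normal
  form has the same shape with \<open>v = e\<^sub>2 + \<i> e\<^sub>3\<close>.\<close>
lemma square_zero_isomorphic:
  assumes A: "so3_hom_lie A" and "\<And>x. A (A x) = 0" and "\<exists>x. A x \<noteq> 0"
  shows "so3_isomorphic A (L7_twist 1)"
proof -
  have lin: "Vector_Spaces.linear (*s) (*s) A" and sa: "self_adjoint A"
    using A by (auto simp: so3_hom_lie_iff)
  interpret A: Vector_Spaces.linear "(*s)" "(*s)" A by (rule lin)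
  obtain u where u: "cdot (A u) u \<noteq> 0"
    using self_adjoint_polarization[OF lin sa] assms(3) by blast
  define c where "c = csqrt (cdot (A u) u)"
  have c: "c * c = cdot (A u) u" "c \<noteq> 0"
    using u by (simp_all add: c_def flip: power2_eq_square)
  define y where "y = (1 / c) *s u"
  define v where "v = A y"
  have yv: "cdot y v = 1"
    using c u by (simp add: v_def y_def A.scale cdot_bilinear cdot_commute field_simps)
  have isotropic: "cdot (A x) (A z) = 0" for x z
    using self_adjointD[OF sa, of x "A z"] assms(2) by (simp add: cdot_bilinear)
  have rank_one: "A x = cdot v x *s v" for x
  proof -
    have "cdot v y *s A x = cdot (A x) y *s v"
      unfolding v_def by (rule totally_isotropic_parallel) (rule isotropic)+
    then show ?thesis
      using yv self_adjointD[OF sa, of x y] by (simp add: cdot_commute v_def)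
  qed
  \<comment> \<open>A vector orthogonal to \<open>y\<close> and \<open>v\<close>; the factor makes it a unit vector, as \<open>[y, v]\<close> has square
    \<open>-(y \<cdot> v)\<^sup>2 = -1\<close> for isotropic \<open>v\<close>.\<close>
  define f where "f = \<i> *s so3_bracket y v"
  have "cdot f f = 1" "cdot f v = 0" "cdot f y = 0"
    using yv isotropic[of y y] cdot_bracket_left(1)[of y v] cdot_bracket_left(2)[of v y]
    by (simp_all add: f_def cdot_bilinear bracket_cdot cdot_commute flip: v_def)
  then obtain f2 f3 k where frame: "so3_frame f f2 f3" and v: "v = f2 + k *s f3"
      and k: "k = \<i> \<or> k = - \<i>"
    using isotropic_adapted_frame[of f v y] yv isotropic[of y y] by (metis v_def)
  \<comment> \<open>Negating \<open>f\<close> and \<open>f3\<close>, if necessary, turns \<open>k\<close> into \<open>\<i>\<close> and leaves \<open>v\<close> alone.\<close>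
  define e where "e = - \<i> * k"
  have e: "e = 1 \<or> e = - 1" "k = e * \<i>"
    using k by (auto simp: e_def)
  then have frame': "so3_frame (e *s f) f2 (e *s f3)"
    using frame by (auto simp: so3_frame_def cdot_bilinear so3_bracket_def vec_eq_iff forall_3)
  have v': "v = f2 + \<i> *s (e *s f3)"
    using v e by (simp add: mult.commute)
  note o = so3_frame_orthonormal[OF frame']
  show ?thesis
  proof (rule so3_frame_isomorphic[OF frame' A so3_hom_lie_L7])
    fix x
    have "cdot (e *s f) v = 0" "cdot f2 v = 1" "cdot (e *s f3) v = \<i>"
      unfolding v' by (simp_all only: cdot_bilinear(2) cdot_bilinear(8)[of _ \<i>] o) simp_all
    moreover have "cdot v x = cdot f2 x + \<i> * cdot (e *s f3) x"
      unfolding v' by (simp only: cdot_bilinear(1) cdot_bilinear(7)[of \<i>])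
    moreover have "cdot z (A x) = cdot v x * cdot z v" for z
      by (simp add: rank_one[of x] cdot_bilinear(8)[of _ _ v])
    ultimately show "vector [cdot (e *s f) (A x), cdot f2 (A x), cdot (e *s f3) (A x)] =
         L7_twist 1 (vector [cdot (e *s f) x, cdot f2 x, cdot (e *s f3) x])"
      by (simp add: L7_twist_simps(2) vec_eq_iff forall_3 algebra_simps del: One_nat_def)
  qed simp
qed

text \<open>In the canonical basis \<open>A\<^sub>2\<close> maps \<open>e\<^sub>2\<close> to \<open>e\<^sub>1\<close>, and \<open>e\<^sub>1\<close> to the isotropic vector
  \<open>e\<^sub>2 + \<i> e\<^sub>3\<close> of its kernel. The proof recreates this: from a chain \<open>y, f = A y, v = A f\<close> with
  \<open>A v = 0\<close>, self-adjointness and \<open>A\<^sup>3 = 0\<close> give all products required for an adapted frame, provided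
  \<open>y\<close> is chosen with \<open>y \<cdot> v = 1\<close> and \<open>y \<cdot> f = 0\<close>.\<close>
lemma cube_zero_isomorphic:
  assumes A: "so3_hom_lie A" and cube: "\<And>x. A (A (A x)) = 0" and "\<exists>x. A (A x) \<noteq> 0"
  shows "so3_isomorphic A (L7_twist 2)"
proof -
  have lin: "Vector_Spaces.linear (*s) (*s) A" and sa: "self_adjoint A"
    using A by (auto simp: so3_hom_lie_iff)
  interpret A: Vector_Spaces.linear "(*s)" "(*s)" A by (rule lin)
  have lin2: "Vector_Spaces.linear (*s) (*s) (\<lambda>x. A (A x))"
    by unfold_locales (simp_all add: A.add A.scale)
  have sa2: "self_adjoint (\<lambda>x. A (A x))"
    using sa by (simp add: self_adjoint_def)
  obtain u where u: "cdot (A (A u)) u \<noteq> 0"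
    using self_adjoint_polarization[OF lin2 sa2] assms(3) by blast
  define c where "c = csqrt (cdot (A (A u)) u)"
  have c: "c * c = cdot (A (A u)) u" "c \<noteq> 0"
    using u by (simp_all add: c_def flip: power2_eq_square)
  \<comment> \<open>Subtracting \<open>t A u\<close> achieves \<open>A y \<cdot> y = 0\<close> and does not affect \<open>A\<^sup>2 y\<close>; dividing by \<open>c\<close> then makes
    \<open>A\<^sup>2 y \<cdot> y = 1\<close>.\<close>
  define t where "t = cdot (A u) u / (2 * cdot (A (A u)) u)"
  define y where "y = (1 / c) *s (u - t *s A u)"
  define f where "f = A y"
  define v where "v = A f"
  have "A v = 0" by (simp add: v_def f_def cube)
  have move: "cdot (A x) z = cdot x (A z)" for x z
    by (rule self_adjointD[OF sa])
  have yv: "cdot y v = 1"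
    using c u by (simp add: y_def v_def f_def A.scale A.diff cube cdot_bilinear cdot_commute move
        field_simps)
  have fy: "cdot f y = 0"
  proof -
    have "cdot f y = (1 / c) * (1 / c) * (cdot (A u) u - 2 * t * cdot (A (A u)) u)"
      by (simp add: f_def y_def A.scale A.diff cube cdot_bilinear move algebra_simps)
    also have "\<dots> = 0"
      using u by (simp add: t_def)
    finally show ?thesis .
  qed
  have ff: "cdot f f = 1" using yv by (simp add: f_def v_def move)
  have fv: "cdot f v = 0" "cdot v v = 0"
    using \<open>A v = 0\<close> by (simp_all add: f_def v_def move cdot_bilinear cube)
  obtain f2 f3 k where frame: "so3_frame f f2 f3" and v: "v = f2 + k *s f3"
      and k: "k = \<i> \<or> k = - \<i>" and f2: "f2 = y + ((1 - cdot y y) / 2) *s v"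
    using isotropic_adapted_frame[OF ff fv yv fy] by metis
  \<comment> \<open>Negating \<open>f\<close>, \<open>f2\<close> and with them \<open>v\<close>, if necessary, replaces \<open>k\<close> by \<open>-k\<close>, so that it becomes \<open>\<i>\<close>.\<close>
  define e where "e = - \<i> * k"
  have e: "e = 1 \<or> e = - 1" "k = e * \<i>"
    using k by (auto simp: e_def)
  have frame': "so3_frame (e *s f) (e *s f2) f3"
    using frame e by (auto simp: so3_frame_def cdot_bilinear so3_bracket_def vec_eq_iff forall_3)
  have Af2: "A f2 = f"
    using \<open>A v = 0\<close> by (simp add: f2 f_def A.add A.scale)
  have "A v = f + k *s A f3"
    using v Af2 by (simp add: A.add A.scale)
  with \<open>A v = 0\<close> have "f = - k *s A f3"
    by (simp add: eq_neg_iff_add_eq_0)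
  then have "k *s f = (- k * k) *s A f3" by simp
  also have "- k * k = 1" using k by auto
  finally have Af3: "A f3 = k *s f" by simp
  have Af: "A f = f2 + k *s f3"
    using v by (simp add: v_def)
  show ?thesis
  proof (rule so3_frame_isomorphic[OF frame' A so3_hom_lie_L7])
    fix x
    have "cdot f (A x) = cdot f2 x + k * cdot f3 x" "cdot f2 (A x) = cdot f x"
      "cdot f3 (A x) = k * cdot f x"
      using move[of f x] move[of f2 x] move[of f3 x] by (simp_all add: Af Af2 Af3 cdot_bilinear)
    with e(1) show "vector [cdot (e *s f) (A x), cdot (e *s f2) (A x), cdot f3 (A x)] =
         L7_twist 2 (vector [cdot (e *s f) x, cdot (e *s f2) x, cdot f3 x])"
      by (auto simp: L7_twist_simps(3) vec_eq_iff forall_3 cdot_bilinear e(2))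
  qed simp
qed

lemma self_adjoint_funpow: "self_adjoint A \<Longrightarrow> self_adjoint (A ^^ n)"
  by (induction n) (simp_all add: self_adjoint_def funpow_swap1)

text \<open>Let \<open>N\<close> be the index of nilpotency. For \<open>a = A\<^bsup>N-2\<^esup> z\<close> the product
  \<open>a \<cdot> a = z \<cdot> A\<^bsup>2N-4\<^esup> z\<close> vanishes once \<open>2N - 4 \<ge> N\<close>, that is \<open>N \<ge> 4\<close>. Then \<open>a\<close>
  and \<open>A a \<noteq> 0\<close> would be parallel, although \<open>A (A a) = 0\<close>.\<close>
lemma nilpotent_cube_zero:
  assumes A: "so3_hom_lie A" and "nilpotent_map A"
  shows "A (A (A x)) = 0"
proof -
  have lin: "Vector_Spaces.linear (*s) (*s) A" and sa: "self_adjoint A"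
    using A by (auto simp: so3_hom_lie_iff)
  interpret A: Vector_Spaces.linear "(*s)" "(*s)" A by (rule lin)
  define N where "N = (LEAST n. \<forall>x. (A ^^ n) x = 0)"
  have N: "(A ^^ N) x = 0" for x
    using assms(2) LeastI_ex[of "\<lambda>n. \<forall>x. (A ^^ n) x = 0"] by (auto simp: nilpotent_map_def N_def)
  have large: "(A ^^ m) x = 0" if "m \<ge> N" for m x
    using N[of "(A ^^ (m - N)) x"] that by (simp flip: funpow_add comp_apply[of "A ^^ _" "A ^^ _"])
  have "N \<le> 3"
  proof (rule ccontr)
    assume "\<not> N \<le> 3"
    then obtain m where m: "N = m + 4" using that[of "N - 4"] by simp
    obtain z where z: "(A ^^ (m + 3)) z \<noteq> 0"
      using not_less_Least[of "m + 3" "\<lambda>n. \<forall>x. (A ^^ n) x = 0"] m by (auto simp: N_def)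
    define a where "a = (A ^^ (m + 2)) z"
    define b where "b = (A ^^ (m + 3)) z"
    have Aa: "A a = b" and Ab: "A b = 0"
      using N[of z] by (simp_all add: a_def b_def m numeral_eq_Suc)
    have dot: "cdot ((A ^^ i) z) ((A ^^ j) z) = 0" if "i + j \<ge> N" for i j
      using self_adjointD[OF self_adjoint_funpow[OF sa], of i z "(A ^^ j) z"] large[OF that, of z]
      by (simp add: funpow_add cdot_bilinear)
    have iso: "cdot a a = 0" "cdot a b = 0" "cdot b b = 0"
      unfolding a_def b_def by (rule dot; simp add: m)+
    obtain w where "cdot b w \<noteq> 0"
      using cdot_nondegenerate z b_def by blast
    moreover have "cdot b w *s b = 0"
      using arg_cong[OF totally_isotropic_parallel[OF iso, of w], of A] Aa Ab by (simp add: A.scale)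
    ultimately show False
      using z by (simp add: b_def)
  qed
  from large[OF this, of x] show ?thesis by (simp add: numeral_3_eq_3)
qed

theorem proposition3p3:
  shows "(\<forall>i \<in> {0, 1, 2}. so3_hom_lie (L7_twist i)) \<and>
    (\<forall>A. so3_hom_lie A \<and> nilpotent_map A \<longrightarrow>
       (\<exists>i \<in> {0, 1, 2}. so3_isomorphic A (L7_twist i))) \<and>
    (\<forall>i \<in> {0, 1, 2}. \<forall>j \<in> {0, 1, 2}.
       so3_isomorphic (L7_twist i) (L7_twist j) \<longleftrightarrow> L7_twist i = L7_twist j)"
proof (intro conjI allI impI ballI)
  show "so3_hom_lie (L7_twist i)" if "i \<in> {0, 1, 2}" for i
    using that by (rule so3_hom_lie_L7)
next
  fix A assume A: "so3_hom_lie A \<and> nilpotent_map A"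
  consider "\<forall>x. A x = 0" | "\<exists>x. A x \<noteq> 0" "\<forall>x. A (A x) = 0" | "\<exists>x. A (A x) \<noteq> 0"
    by blast
  then show "\<exists>i \<in> {0, 1, 2}. so3_isomorphic A (L7_twist i)"
  proof cases
    case 1
    then have "A = L7_twist 0" by (auto simp: L7_twist_simps)
    then show ?thesis using so3_isomorphic_refl A by blast
  next
    case 2
    then show ?thesis using square_zero_isomorphic A by blast
  next
    case 3
    then show ?thesis using cube_zero_isomorphic nilpotent_cube_zero A by blast
  qed
next
  fix i j :: nat assume ij: "i \<in> {0, 1, 2}" "j \<in> {0, 1, 2}"
  show "so3_isomorphic (L7_twist i) (L7_twist j) \<longleftrightarrow> L7_twist i = L7_twist j"
    using L7_twist_nonisomorphic[OF ij] so3_isomorphic_refl[OF so3_hom_lie_L7[OF ij(2)]] by metis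
qed

end
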